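(* For every integer $d\ge 2$, the natural projection $N_d\to \mathrm{M}_d$, sending a normalized rational function $R\in N_d$ to its Möbius conjugacy class, is surjective. That is, every rational function of degree $d$ with complex coefficients is conjugate, by a Möbius transformation of the Riemann sphere, to an element of $N_d$.
   Context: For an integer $d>1$, $\mathrm{Rat}_d$ denotes the set of all rational functions of degree $d$ over $\mathbb{C}$ (viewed as self-maps of the Riemann sphere), and $\mathrm{M}_d$ denotes the set of all Möbius conjugacy classes of elements of $\mathrm{Rat}_d$ (where $R$ is conjugate to $T^{-1}\circ R\circ T$ for every Möbius transformation $T$). The canonical family $C_d$ is the set of all $R=P/Q\in \mathrm{Rat}_d$ with polynomials $P(z)=a_dz^d+\cdots+a_0$ and $Q(z)=z^d+b_{d-1}z^{d-1}+\cdots+b_0$, where $Q$ is monic of degree exactly $d$, $P$ has degree at most $d$, and the resultant of $P$ and $Q$ is nonzero (i.e. $P$ and $Q$ have no common zero). The normalized family $N_d$ is the set of those $R=P/Q\in C_d$ for which $a_0=0$, $b_1=-1$ and $b_0=1$, that is, $$N_d=\left\{\frac{a_dz^d+\cdots+a_1z}{z^d+b_{d-1}z^{d-1}+\cdots+b_2z^2-z+1}\in C_d\right\}.$$ *)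

theory Defs
  imports
    Complex_Main
    "HOL-Computational_Algebra.Polynomial_Factorial"
    "HOL-Computational_Algebra.Field_as_Ring"
    "Subresultants.Subresultant_Gcd"
begin

datatype riemann_sphere = Fin complex | Infty

type_synonym sphere_map = "riemann_sphere \<Rightarrow> riemann_sphere"

text \<open>
  The self-map of the sphere induced by \<open>P/Q\<close>, intended for coprime \<open>P\<close> and \<open>Q\<close>. With
  \<open>n = max (degree P) (degree Q)\<close> the value at infinity is the ratio of the coefficients of
  \<open>z^n\<close>, which covers the cases \<open>degree P < degree Q\<close> (value 0), \<open>degree P > degree Q\<close>
  (value infinity) and \<open>degree P = degree Q\<close> at once.
\<close>

definition rat_map :: "complex poly \<Rightarrow> complex poly \<Rightarrow> sphere_map" where
  "rat_map P Q w =
     (case w of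
        Fin z \<Rightarrow> if poly Q z = 0 then Infty else Fin (poly P z / poly Q z)
      | Infty \<Rightarrow>
          let n = max (degree P) (degree Q)
          in if coeff Q n = 0 then Infty else Fin (coeff P n / coeff Q n))"

definition Rat_d :: "nat \<Rightarrow> sphere_map set" where
  "Rat_d d = {rat_map P Q | P Q. coprime P Q \<and> max (degree P) (degree Q) = d}"

definition Moebius :: "sphere_map set" where
  "Moebius = {rat_map [:b, a:] [:d, c:] | a b c d. a * d - b * c \<noteq> 0}"

text \<open>
  The inverse is written \<open>inv_into UNIV T\<close> because the usual notation for it is taken by the
  group inverse of HOL-Algebra.
\<close>

definition moebius_conj :: "sphere_map rel" where
  "moebius_conj = {(R, S). \<exists>T\<in>Moebius. S = inv_into UNIV T \<circ> R \<circ> T}"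

definition moebius_class :: "sphere_map \<Rightarrow> sphere_map set" where
  "moebius_class R = moebius_conj `` {R}"

text \<open>
  The relation lives on all self-maps of the sphere; a Moebius conjugate of an element of
  \<open>Rat_d d\<close> is again in \<open>Rat_d d\<close>, so the classes below consist of maps of degree \<open>d\<close>.
\<close>

definition M_d :: "nat \<Rightarrow> sphere_map set set" where
  "M_d d = Rat_d d // moebius_conj"

text \<open>
  The resultant here is taken with respect to the actual degrees of \<open>P\<close> and \<open>Q\<close>. As \<open>Q\<close> is
  monic of degree \<open>d\<close>, it vanishes exactly when the one with formal degrees \<open>(d, d)\<close> does.
\<close>

definition canonical_form :: "nat \<Rightarrow> complex poly \<Rightarrow> complex poly \<Rightarrow> bool" where
  "canonical_form d P Q \<longleftrightarrow>
     degree P \<le> d \<and> degree Q = d \<and> lead_coeff Q = 1 \<and> resultant P Q \<noteq> 0"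

definition C_d :: "nat \<Rightarrow> sphere_map set" where
  "C_d d = {rat_map P Q | P Q. canonical_form d P Q}"

definition N_d :: "nat \<Rightarrow> sphere_map set" where
  "N_d d = {rat_map P Q | P Q.
     canonical_form d P Q \<and> coeff P 0 = 0 \<and> coeff Q 1 = -1 \<and> coeff Q 0 = 1}"

lemma N_d_subset_C_d: "N_d d \<subseteq> C_d d"
  by (auto simp: N_d_def C_d_def)

lemma C_d_subset_Rat_d: "C_d d \<subseteq> Rat_d d"
proof
  fix R assume "R \<in> C_d d"
  then obtain P Q where R: "R = rat_map P Q" and PQ: "canonical_form d P Q"
    by (auto simp: C_d_def)
  have "Q \<noteq> 0" "degree (gcd P Q) = 0"
    using PQ by (auto simp: canonical_form_def resultant_0_gcd)
  then have "coprime P Q"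
    by (metis gcd_eq_0_iff is_unit_gcd is_unit_iff_degree)
  then show "R \<in> Rat_d d"
    using PQ R by (auto simp: Rat_d_def canonical_form_def max_def)
qed

lemma Moebius_left_inverse:
  assumes D: "a * d - b * c \<noteq> 0"
  shows "rat_map [:-b, d:] [:a, -c:] (rat_map [:b, a:] [:d, c:] w) = w"
proof (cases w)
  case (Fin z)
  show ?thesis
  proof (cases "d + z * c = 0")
    case True
    then have d: "d = - (z * c)"
      by (simp add: eq_neg_iff_add_eq_0)
    then have "c \<noteq> 0" using D by auto
    then show ?thesis using d
      by (simp add: Fin rat_map_def Let_def)
  next
    case False
    have "a - (b + z * a) / (d + z * c) * c = (a * d - b * c) / (d + z * c)"
      using False by (simp add: field_simps)
    moreover have "-b + (b + z * a) / (d + z * c) * d = z * (a * d - b * c) / (d + z * c)"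
      using False by (simp add: field_simps)
    ultimately show ?thesis using False D
      by (simp add: Fin rat_map_def)
  qed
next
  case Infty
  then show ?thesis using D
    by (cases "c = 0") (auto simp: rat_map_def Let_def field_simps)
qed

lemma bij_Moebius:
  assumes "T \<in> Moebius"
  shows "bij T" and "inv_into UNIV T \<in> Moebius"
proof -
  obtain a b c d where T: "T = rat_map [:b, a:] [:d, c:]" and D: "a * d - b * c \<noteq> 0"
    using assms by (auto simp: Moebius_def)
  define S where "S = rat_map [:-b, d:] [:a, -c:]"
  have 1: "S (T w) = w" for w
    unfolding S_def T by (rule Moebius_left_inverse[OF D])
  have 2: "T (S w) = w" for w
    using Moebius_left_inverse[of d a "-b" "-c" w] D
    unfolding S_def T by (simp add: mult.commute)
  show "bij T"
    using 1 2 by (metis bij_betw_def inj_def surj_def)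
  have "inv_into UNIV T = S"
    using 1 2 by (intro inv_equality) auto
  moreover have "S \<in> Moebius"
    unfolding S_def Moebius_def using D
    by (intro CollectI exI[of _ d] exI[of _ "-b"] exI[of _ "-c"] exI[of _ a])
      (simp add: mult.commute)
  ultimately show "inv_into UNIV T \<in> Moebius" by simp
qed

lemma id_Moebius: "id \<in> Moebius"
proof -
  have "id = rat_map [:0, 1:] [:1, 0:]"
    by (auto simp: rat_map_def fun_eq_iff Let_def split: riemann_sphere.splits)
  then show ?thesis
    unfolding Moebius_def
    by (intro CollectI exI[of _ 1] exI[of _ 0]) simp
qed

lemma comp_rat_map_linear:
  assumes D: "a * d - b * c \<noteq> 0" and D': "a' * d' - b' * c' \<noteq> 0"
  shows "rat_map [:b, a:] [:d, c:] \<circ> rat_map [:b', a':] [:d', c':]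
       = rat_map [:a * b' + b * d', a * a' + b * c':] [:c * b' + d * d', c * a' + d * c':]"
proof
  have at_Infty: "rat_map [:b, a:] [:d, c:] Infty = (if c = 0 then Infty else Fin (a / c))"
    if "a * d - b * c \<noteq> 0" for a b c d
    using that by (auto simp: rat_map_def Let_def)
  have at_Fin: "rat_map [:b, a:] [:d, c:] (Fin z) =
      (if c * z + d = 0 then Infty else Fin ((a * z + b) / (c * z + d)))" for a b c d z
    by (simp add: rat_map_def algebra_simps)
  have D'': "(a * a' + b * c') * (c * b' + d * d') - (a * b' + b * d') * (c * a' + d * c') \<noteq> 0"
  proof -
    have "(a * a' + b * c') * (c * b' + d * d') - (a * b' + b * d') * (c * a' + d * c')
        = (a * d - b * c) * (a' * d' - b' * c')" by (simp add: algebra_simps)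
    then show ?thesis using D D' by simp
  qed
  fix w
  show "(rat_map [:b, a:] [:d, c:] \<circ> rat_map [:b', a':] [:d', c':]) w
      = rat_map [:a * b' + b * d', a * a' + b * c':] [:c * b' + d * d', c * a' + d * c':] w"
  proof (cases w)
    case (Fin z)
    have num: "(a * a' + b * c') * z + (a * b' + b * d') = a * (a' * z + b') + b * (c' * z + d')"
      and den: "(c * a' + d * c') * z + (c * b' + d * d') = c * (a' * z + b') + d * (c' * z + d')"
      by (simp_all add: algebra_simps)
    define p q where "p = a' * z + b'" and "q = c' * z + d'"
    have rhs: "rat_map [:a * b' + b * d', a * a' + b * c':] [:c * b' + d * d', c * a' + d * c':] w
        = (if c * p + d * q = 0 then Infty else Fin ((a * p + b * q) / (c * p + d * q)))"
      unfolding Fin at_Fin num den p_def q_def ..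
    have lhs: "rat_map [:b', a':] [:d', c':] w = (if q = 0 then Infty else Fin (p / q))"
      unfolding Fin at_Fin p_def q_def ..
    show ?thesis
    proof (cases "q = 0")
      case True
      have "p \<noteq> 0"
      proof
        assume "p = 0"
        with True have "b' = - (a' * z)" "d' = - (c' * z)"
          unfolding p_def q_def by (simp_all add: eq_neg_iff_add_eq_0 add.commute)
        then have "a' * d' - b' * c' = 0" by simp
        with D' show False by simp
      qed
      then show ?thesis
        unfolding comp_def lhs rhs using True by (simp add: at_Infty[OF D])
    next
      case False
      have e: "x * (p / q) + y = (x * p + y * q) / q" for x y
        using False by (simp add: add_divide_distrib)
      have e': "u / q = 0 \<longleftrightarrow> u = 0" "(u / q) / (v / q) = u / v" for u v
        using False by simp_all
      have "rat_map [:b, a:] [:d, c:] (Fin (p / q))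
          = (if c * p + d * q = 0 then Infty else Fin ((a * p + b * q) / (c * p + d * q)))"
        unfolding at_Fin e e' ..
      then show ?thesis
        unfolding comp_def lhs rhs using False by simp
    qed
  next
    case Infty
    show ?thesis
    proof (cases "c' = 0")
      case True
      then have "a' \<noteq> 0" using D' by auto
      then show ?thesis
        unfolding Infty comp_def at_Infty[OF D'] at_Infty[OF D'']
        using True by (simp add: at_Infty[OF D])
    next
      case False
      have e: "x * (a' / c') + y = (x * a' + y * c') / c'" for x y
        using False by (simp add: add_divide_distrib)
      have e': "u / c' = 0 \<longleftrightarrow> u = 0" "(u / c') / (v / c') = u / v" for u v
        using False by simp_all
      have "rat_map [:b, a:] [:d, c:] (Fin (a' / c'))
          = (if c * a' + d * c' = 0 then Infty else Fin ((a * a' + b * c') / (c * a' + d * c')))"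
        unfolding at_Fin e e' ..
      then show ?thesis
        unfolding Infty comp_def at_Infty[OF D'] at_Infty[OF D'']
        using False by simp
    qed
  qed
qed

lemma comp_Moebius:
  assumes "S \<in> Moebius" "T \<in> Moebius"
  shows "S \<circ> T \<in> Moebius"
proof -
  obtain a b c d where S: "S = rat_map [:b, a:] [:d, c:]" and D: "a * d - b * c \<noteq> 0"
    using assms(1) by (auto simp: Moebius_def)
  obtain a' b' c' d' where T: "T = rat_map [:b', a':] [:d', c':]" and D': "a' * d' - b' * c' \<noteq> 0"
    using assms(2) by (auto simp: Moebius_def)
  have "(a * a' + b * c') * (c * b' + d * d') - (a * b' + b * d') * (c * a' + d * c')
      = (a * d - b * c) * (a' * d' - b' * c')" by (simp add: algebra_simps)
  then have "(a * a' + b * c') * (c * b' + d * d') - (a * b' + b * d') * (c * a' + d * c') \<noteq> 0"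
    using D D' by simp
  then show ?thesis
    unfolding S T comp_rat_map_linear[OF D D'] Moebius_def by blast
qed

lemma equiv_moebius_conj: "equiv UNIV moebius_conj"
proof (rule equivI)
  show "moebius_conj \<subseteq> UNIV \<times> UNIV" by simp
  show "refl moebius_conj"
  proof (rule refl_onI)
    fix R :: sphere_map
    have "R = inv_into UNIV id \<circ> R \<circ> id" by simp
    then show "(R, R) \<in> moebius_conj"
      using id_Moebius unfolding moebius_conj_def by blast
  qed
  show "sym moebius_conj"
  proof (rule symI)
    fix R S assume "(R, S) \<in> moebius_conj"
    then obtain T where T: "T \<in> Moebius" and S: "S = inv_into UNIV T \<circ> R \<circ> T"
      by (auto simp: moebius_conj_def)
    have "bij T" using T by (rule bij_Moebius)
    then have "R = inv_into UNIV (inv_into UNIV T) \<circ> S \<circ> inv_into UNIV T"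
      by (simp add: S fun_eq_iff inv_inv_eq bij_is_surj surj_f_inv_f)
    then show "(S, R) \<in> moebius_conj"
      using bij_Moebius(2)[OF T] unfolding moebius_conj_def by blast
  qed
  show "trans moebius_conj"
  proof (rule transI)
    fix R S U assume "(R, S) \<in> moebius_conj" "(S, U) \<in> moebius_conj"
    then obtain T T' where T: "T \<in> Moebius" "S = inv_into UNIV T \<circ> R \<circ> T"
      and T': "T' \<in> Moebius" "U = inv_into UNIV T' \<circ> S \<circ> T'"
      by (auto simp: moebius_conj_def)
    have "U = inv_into UNIV (T \<circ> T') \<circ> R \<circ> (T \<circ> T')"
      using T T' bij_Moebius(1) by (simp add: o_inv_distrib comp_assoc)
    then show "(R, U) \<in> moebius_conj"
      using comp_Moebius[OF T(1) T'(1)] unfolding moebius_conj_def by blast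
  qed
qed

end

theory Submission
  imports Defs "HOL-Computational_Algebra.Fundamental_Theorem_Algebra"
begin

text \<open>
  Each condition in the definition of \<open>N_d\<close> is a normalization of the coordinate. That \<open>P(0) = 0\<close>
  says that \<open>0\<close> is a fixed point, that \<open>Q\<close> has degree \<open>d\<close> says that infinity is not one, and what
  remains is to make the coefficients \<open>b\<^sub>0\<close>, \<open>b\<^sub>1\<close> and \<open>b\<^sub>d\<close> of the denominator proportional to
  \<open>1, -1, 1\<close>. Let \<open>P/Q\<close> have a fixed point at \<open>0\<close> with multiplier \<open>\<mu>\<close>, scaled so that \<open>Q(0) = 1\<close>, and
  conjugate by \<open>T(z) = z / (c z + \<kappa>)\<close>. The new denominator has \<open>b\<^sub>0 = \<kappa>\<^sup>d\<close>, \<open>b\<^sub>1 = - \<kappa>\<^bsup>d-1\<^esup> M(c)\<close> with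
  \<open>M(c) = (\<mu> - d) c - b\<close>, where \<open>b\<close> is the linear coefficient of \<open>Q\<close>, and \<open>b\<^sub>d = L(c)\<close>, where \<open>L\<close> is a
  polynomial whose zeros are the \<open>c\<close> with \<open>1/c\<close> a fixed point. So the choice \<open>\<kappa> = M(c)\<close> works as soon
  as \<open>c\<close> satisfies \<open>L(c) = M(c)\<^sup>d \<noteq> 0\<close>.

  The coefficient of \<open>c\<^sup>d\<close> in \<open>F = L - M\<^sup>d\<close> is \<open>(1 - \<mu>) - (\<mu> - d)\<^sup>d\<close>. If this does not vanish and
  \<open>\<mu> \<noteq> d\<close>, then \<open>F\<close> has degree \<open>d\<close>, and a zero of \<open>F\<close> outside the only zero \<open>c\<^sub>0\<close> of \<open>M\<close> is missing
  only if \<open>F\<close>, and hence \<open>L\<close>, is a constant multiple of \<open>(c - c\<^sub>0)\<^sup>d\<close>; then \<open>1/c\<^sub>0\<close> is a multiple fixed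
  point, and \<open>\<mu> \<noteq> 1\<close> because \<open>L\<close> is not zero. This is \<open>exists_normalizing_pole\<close>.

  For a given fixed point these conditions can fail: \<open>z\<^sup>2\<close> at its fixed point \<open>1\<close> has \<open>\<mu> = d\<close> and
  \<open>M = 0\<close>. The fixed point must therefore be chosen. If some fixed point is multiple, it has
  \<open>\<mu> = 1\<close> and can be taken. Otherwise all are simple, and the holomorphic fixed point formula says
  that the sum of \<open>1 / (1 - \<mu>)\<close> over the fixed points is \<open>1\<close>, so that some of them has \<open>Re \<mu> < 1\<close>
  (\<open>fixed_point_Re_multiplier_le_1\<close>). In both cases \<open>Re \<mu> \<le> 1\<close>, and this gives
  \<open>\<bar>\<mu> - d\<bar>\<^sup>d > \<bar>1 - \<mu>\<bar>\<close> (\<open>norm_shift_power_gt\<close>), so both conditions on \<open>\<mu>\<close> hold.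
\<close>

section \<open>Rational maps in homogeneous coordinates\<close>

text \<open>
  Points of the sphere are handled as pairs \<open>(x, y)\<close> other than \<open>(0, 0)\<close>, standing for \<open>x/y\<close>. A map
  \<open>P/Q\<close> of degree \<open>d\<close> then acts through the forms of degree \<open>d\<close> obtained from \<open>P\<close> and \<open>Q\<close>, and
  infinity needs a case distinction only in the few basic facts about these forms.
\<close>

definition hom_eval :: "nat \<Rightarrow> complex poly \<Rightarrow> complex \<Rightarrow> complex \<Rightarrow> complex" where
  "hom_eval d P x y = (\<Sum>i\<le>d. coeff P i * x ^ i * y ^ (d - i))"

definition hom_point :: "complex \<Rightarrow> complex \<Rightarrow> riemann_sphere" where
  "hom_point x y = (if y = 0 then Infty else Fin (x / y))"

lemma hom_point_cases:
  obtains x y where "w = hom_point x y" "x \<noteq> 0 \<or> y \<noteq> 0"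
proof (cases w)
  case (Fin z)
  then show ?thesis using that[of z 1] by (simp add: hom_point_def)
next
  case Infty
  then show ?thesis using that[of 1 0] by (simp add: hom_point_def)
qed

lemma hom_point_scale: "k \<noteq> 0 \<Longrightarrow> hom_point (k * x) (k * y) = hom_point x y"
  by (simp add: hom_point_def)

lemma hom_eval_affine:
  assumes "degree P \<le> d" "y \<noteq> 0"
  shows "hom_eval d P x y = y ^ d * poly P (x / y)"
proof -
  have affine: "poly P (x / y) = (\<Sum>i\<le>d. coeff P i * (x / y) ^ i)"
    unfolding poly_altdef
    by (rule sum.mono_neutral_left) (use assms in \<open>auto simp: coeff_eq_0\<close>)
  have summand: "coeff P i * x ^ i * y ^ (d - i) = y ^ d * (coeff P i * (x / y) ^ i)"
    if "i \<le> d" for i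
    using that assms by (simp add: power_divide power_diff field_simps)
  have "hom_eval d P x y = (\<Sum>i\<le>d. y ^ d * (coeff P i * (x / y) ^ i))"
    unfolding hom_eval_def by (intro sum.cong refl summand) simp
  then show ?thesis by (simp only: affine sum_distrib_left)
qed

lemma hom_eval_infinity: "hom_eval d P x 0 = coeff P d * x ^ d"
proof -
  have "hom_eval d P x 0 = (\<Sum>i\<in>{d}. coeff P i * x ^ i * 0 ^ (d - i))"
    unfolding hom_eval_def by (rule sum.mono_neutral_right) auto
  then show ?thesis by simp
qed

lemma hom_eval_diff: "hom_eval d (P - Q) x y = hom_eval d P x y - hom_eval d Q x y"
  unfolding hom_eval_def by (simp add: sum_subtractf left_diff_distrib)

lemma hom_eval_smult: "hom_eval d (smult k P) x y = k * hom_eval d P x y"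
  unfolding hom_eval_def by (simp add: sum_distrib_left mult.assoc)

lemma rat_map_hom_point:
  assumes d: "max (degree P) (degree Q) = d" and xy: "x \<noteq> 0 \<or> y \<noteq> 0"
  shows "rat_map P Q (hom_point x y) = hom_point (hom_eval d P x y) (hom_eval d Q x y)"
proof (cases "y = 0")
  case True
  with xy have "x \<noteq> 0" by simp
  then show ?thesis
    using d by (simp add: True hom_point_def rat_map_def hom_eval_infinity Let_def)
next
  case False
  have "degree P \<le> d" "degree Q \<le> d" using d by auto
  then show ?thesis
    using False by (simp add: hom_point_def rat_map_def hom_eval_affine)
qed

lemma rat_map_linear_hom_point:
  assumes D: "a * e - b * c \<noteq> 0" and xy: "x \<noteq> 0 \<or> y \<noteq> 0"
  shows "rat_map [:b, a:] [:e, c:] (hom_point x y) = hom_point (a * x + b * y) (c * x + e * y)"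
proof -
  have "max (degree [:b, a:]) (degree [:e, c:]) = 1"
    using D by auto
  then show ?thesis
    using rat_map_hom_point[of "[:b, a:]" "[:e, c:]" 1 x y] xy
    by (simp add: hom_eval_def add.commute)
qed

lemma coprime_poly_no_common_root:
  assumes "coprime P Q" "poly P z = 0" "poly Q z = (0::complex)"
  shows False
proof -
  have "is_unit [:-z, 1:]"
    using assms by (meson coprime_def poly_eq_0_iff_dvd)
  then show False by (simp add: is_unit_iff_degree)
qed

lemma coprime_if_no_common_root:
  fixes P Q :: "complex poly"
  assumes "\<And>z. poly P z = 0 \<Longrightarrow> poly Q z = 0 \<Longrightarrow> False"
  shows "coprime P Q"
proof (rule coprimeI)
  fix r assume r: "r dvd P" "r dvd Q"
  show "is_unit r"
  proof (rule ccontr)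
    assume "\<not> is_unit r"
    moreover have "r \<noteq> 0" using r assms[of 0] by auto
    ultimately have "degree r \<noteq> 0" by (simp add: is_unit_iff_degree)
    then obtain z where "poly r z = 0"
      using fundamental_theorem_of_algebra[of r] by (auto simp: constant_degree)
    then show False using r assms[of z] by (metis dvd_trans poly_eq_0_iff_dvd)
  qed
qed

lemma coprime_smult_both:
  fixes P Q :: "complex poly"
  assumes "k \<noteq> 0" "coprime P Q"
  shows "coprime (smult k P) (smult k Q)"
proof (rule coprime_if_no_common_root)
  fix z assume "poly (smult k P) z = 0" "poly (smult k Q) z = 0"
  then show False
    using assms(1) coprime_poly_no_common_root[OF assms(2), of z] by simp
qed

lemma hom_eval_no_common_zero:
  assumes cop: "coprime P Q" and d: "max (degree P) (degree Q) = d" and xy: "x \<noteq> 0 \<or> y \<noteq> 0"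
  shows "hom_eval d P x y \<noteq> 0 \<or> hom_eval d Q x y \<noteq> 0"
proof (cases "y = 0")
  case True
  have "P \<noteq> 0 \<or> Q \<noteq> 0" using cop by auto
  then have "coeff P d \<noteq> 0 \<or> coeff Q d \<noteq> 0"
    using d eq_zero_or_degree_less[of P d] eq_zero_or_degree_less[of Q d]
    by (auto simp: max_def split: if_splits)
  then show ?thesis using True xy by (simp add: hom_eval_infinity)
next
  case False
  have "degree P \<le> d" "degree Q \<le> d" using d by auto
  then show ?thesis
    using False coprime_poly_no_common_root[OF cop, of "x / y"] by (auto simp: hom_eval_affine)
qed

section \<open>Conjugation by a Moebius transformation\<close>

text \<open>
  The polynomial \<open>V\<^sup>d P(U/V)\<close>, the form of degree \<open>d\<close> belonging to \<open>P\<close> evaluated at \<open>(U, V)\<close>.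
\<close>

definition hom_subst :: "nat \<Rightarrow> complex poly \<Rightarrow> complex poly \<Rightarrow> complex poly \<Rightarrow> complex poly" where
  "hom_subst d P U V = (\<Sum>i\<le>d. smult (coeff P i) (U ^ i * V ^ (d - i)))"

lemma poly_hom_subst: "poly (hom_subst d P U V) z = hom_eval d P (poly U z) (poly V z)"
  by (simp add: hom_subst_def hom_eval_def poly_sum mult.assoc)

lemma coeff_mult_top:
  fixes p q :: "'a::comm_semiring_0 poly"
  assumes "degree p \<le> m" "degree q \<le> n"
  shows "coeff (p * q) (m + n) = coeff p m * coeff q n"
proof -
  have "coeff (p * q) (m + n) = (\<Sum>i\<in>{m}. coeff p i * coeff q (m + n - i))"
    unfolding coeff_mult
  proof (rule sum.mono_neutral_right)
    show "\<forall>i\<in>{..m + n} - {m}. coeff p i * coeff q (m + n - i) = 0"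
    proof
      fix i assume "i \<in> {..m + n} - {m}"
      then have "i > m \<or> m + n - i > n" by auto
      then show "coeff p i * coeff q (m + n - i) = 0"
        using assms by (auto simp: coeff_eq_0)
    qed
  qed auto
  then show ?thesis by simp
qed

lemma degree_linear_power_le: "degree ([:b, a:] ^ n) \<le> n" for a :: "'a::comm_semiring_1"
proof -
  have "degree [:b, a:] * n \<le> 1 * n" by (intro mult_le_mono1) simp
  then show ?thesis using degree_power_le[of "[:b, a:]" n] by linarith
qed

lemma coeff_linear_power_top: "coeff ([:b, a:] ^ n) n = a ^ n" for a :: "'a::comm_semiring_1"
proof (induction n)
  case (Suc n)
  have "coeff ([:b, a:] * [:b, a:] ^ n) (1 + n) = coeff [:b, a:] 1 * coeff ([:b, a:] ^ n) n"
    by (rule coeff_mult_top) (simp_all add: degree_linear_power_le)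
  then show ?case using Suc by simp
qed simp

lemma hom_subst_linear:
  shows degree_hom_subst: "degree (hom_subst d P [:b, a:] [:e, c:]) \<le> d"
    and coeff_hom_subst_top: "coeff (hom_subst d P [:b, a:] [:e, c:]) d = hom_eval d P a c"
proof -
  have *: "degree ([:b, a:] ^ i * [:e, c:] ^ (d - i)) \<le> d" if "i \<le> d" for i
    using degree_mult_le[of "[:b, a:] ^ i" "[:e, c:] ^ (d - i)"]
      degree_linear_power_le[of b a i] degree_linear_power_le[of e c "d - i"] that by linarith
  show "degree (hom_subst d P [:b, a:] [:e, c:]) \<le> d"
    unfolding hom_subst_def
    by (rule degree_sum_le) (use * degree_smult_le order_trans in \<open>auto intro: order_trans\<close>)
  have "coeff ([:b, a:] ^ i * [:e, c:] ^ (d - i)) d = a ^ i * c ^ (d - i)" if "i \<le> d" for i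
    using coeff_mult_top[OF degree_linear_power_le[of b a i] degree_linear_power_le[of e c "d - i"]] that
    by (simp add: coeff_linear_power_top)
  then show "coeff (hom_subst d P [:b, a:] [:e, c:]) d = hom_eval d P a c"
    by (simp add: hom_subst_def hom_eval_def coeff_sum mult.assoc)
qed

lemma hom_eval_homogeneous:
  "hom_eval d P (k * x) (k * y) = k ^ d * hom_eval d P x y"
proof -
  have "k ^ i * k ^ (d - i) = k ^ d" if "i \<le> d" for i
    using that by (simp flip: power_add)
  then have summand: "coeff P i * (k * x) ^ i * (k * y) ^ (d - i) = k ^ d * (coeff P i * x ^ i * y ^ (d - i))"
    if "i \<le> d" for i
    using that by (simp add: power_mult_distrib mult_ac)
  show ?thesis
    unfolding hom_eval_def sum_distrib_left by (intro sum.cong refl summand) simp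
qed

lemma hom_eval_hom_subst:
  "hom_eval d (hom_subst d P [:b, a:] [:e, c:]) x y = hom_eval d P (a * x + b * y) (c * x + e * y)"
proof (cases "y = 0")
  case True
  then show ?thesis
    using hom_eval_homogeneous[of d P x a c]
    by (simp add: hom_eval_infinity coeff_hom_subst_top mult.commute)
next
  case False
  have "hom_eval d (hom_subst d P [:b, a:] [:e, c:]) x y
      = y ^ d * hom_eval d P (b + x / y * a) (e + x / y * c)"
    using False by (simp add: hom_eval_affine degree_hom_subst poly_hom_subst)
  also have "\<dots> = hom_eval d P (y * (b + x / y * a)) (y * (e + x / y * c))"
    by (simp add: hom_eval_homogeneous)
  also have "y * (b + x / y * a) = a * x + b * y" using False by (simp add: distrib_left)
  also have "y * (e + x / y * c) = c * x + e * y" using False by (simp add: distrib_left)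
  finally show ?thesis .
qed

text \<open>
  With the matrix of \<open>T\<close> acting on pairs, \<open>R \<circ> T\<close> is given by the substituted forms of \<open>P\<close> and \<open>Q\<close>,
  and \<open>P'\<close> and \<open>Q'\<close> arise from these by the adjugate matrix, which represents the inverse of \<open>T\<close> up
  to a scalar. The assumption that \<open>Q'\<close> has a nonzero coefficient in degree \<open>d\<close> says that infinity is not
  fixed by the conjugate; it makes \<open>d\<close> the actual degree of the new pair.
\<close>

lemma moebius_conj_rat_map:
  assumes cop: "coprime P Q" and d: "max (degree P) (degree Q) = d"
    and D: "a * e - b * c \<noteq> 0"
    and P': "P' = smult e (hom_subst d P [:b, a:] [:e, c:]) - smult b (hom_subst d Q [:b, a:] [:e, c:])"
    and Q': "Q' = smult a (hom_subst d Q [:b, a:] [:e, c:]) - smult c (hom_subst d P [:b, a:] [:e, c:])"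
    and nz: "coeff Q' d \<noteq> 0"
  shows "coprime P' Q'" "degree P' \<le> d" "degree Q' = d"
    and "(rat_map P Q, rat_map P' Q') \<in> moebius_conj"
proof -
  let ?p = "\<lambda>x y. hom_eval d P (a * x + b * y) (c * x + e * y)"
  let ?q = "\<lambda>x y. hom_eval d Q (a * x + b * y) (c * x + e * y)"
  have degs: "degree P' \<le> d" "degree Q' \<le> d"
    unfolding P' Q'
    by (auto intro!: degree_diff_le order_trans[OF degree_smult_le] degree_hom_subst)
  then show "degree P' \<le> d" "degree Q' = d"
    using nz le_degree[of Q' d] by auto
  then have d': "max (degree P') (degree Q') = d" by simp
  have HP': "hom_eval d P' x y = e * ?p x y - b * ?q x y"
    and HQ': "hom_eval d Q' x y = a * ?q x y - c * ?p x y" for x y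
    unfolding P' Q' hom_eval_diff hom_eval_smult hom_eval_hom_subst by simp_all
  \<comment> \<open>The matrix times its adjugate is the determinant.\<close>
  have recombine: "a * hom_eval d P' x y + b * hom_eval d Q' x y = (a * e - b * c) * ?p x y"
    "c * hom_eval d P' x y + e * hom_eval d Q' x y = (a * e - b * c) * ?q x y" for x y
    unfolding HP' HQ' by (simp_all add: algebra_simps)
  have M_nz: "a * x + b * y \<noteq> 0 \<or> c * x + e * y \<noteq> 0" if "x \<noteq> 0 \<or> y \<noteq> 0" for x y
  proof (rule ccontr)
    assume "\<not> ?thesis"
    then have z: "a * x + b * y = 0" "c * x + e * y = 0" by auto
    have "(a * e - b * c) * x = e * (a * x + b * y) - b * (c * x + e * y)"
      "(a * e - b * c) * y = a * (c * x + e * y) - c * (a * x + b * y)"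
      by (simp_all add: algebra_simps)
    then show False using z D that by simp
  qed
  have nz': "hom_eval d P' x y \<noteq> 0 \<or> hom_eval d Q' x y \<noteq> 0" if "x \<noteq> 0 \<or> y \<noteq> 0" for x y
    using hom_eval_no_common_zero[OF cop d M_nz[OF that]] recombine[of x y] D by auto
  show "coprime P' Q'"
  proof (rule coprime_if_no_common_root)
    fix z assume "poly P' z = 0" "poly Q' z = 0"
    then show False using nz'[of z 1] degs by (simp add: hom_eval_affine)
  qed
  define T where "T = rat_map [:b, a:] [:e, c:]"
  have T: "T \<in> Moebius" unfolding T_def Moebius_def using D by blast
  have "rat_map P Q (T w) = T (rat_map P' Q' w)" for w
  proof -
    obtain x y where w: "w = hom_point x y" and xy: "x \<noteq> 0 \<or> y \<noteq> 0" by (rule hom_point_cases)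
    have "T (rat_map P' Q' w)
        = hom_point ((a * e - b * c) * ?p x y) ((a * e - b * c) * ?q x y)"
      unfolding w T_def rat_map_hom_point[OF d' xy] rat_map_linear_hom_point[OF D nz'[OF xy]] recombine ..
    also have "\<dots> = rat_map P Q (T w)"
      unfolding w T_def rat_map_linear_hom_point[OF D xy] rat_map_hom_point[OF d M_nz[OF xy]]
      by (rule hom_point_scale[OF D])
    finally show ?thesis ..
  qed
  then have "rat_map P' Q' = inv_into UNIV T \<circ> rat_map P Q \<circ> T"
    using bij_Moebius(1)[OF T] by (simp add: fun_eq_iff bij_is_inj)
  then show "(rat_map P Q, rat_map P' Q') \<in> moebius_conj"
    using T unfolding moebius_conj_def by blast
qed

lemma rat_map_smult:
  assumes "k \<noteq> 0"
  shows "rat_map (smult k P) (smult k Q) = rat_map P Q"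
proof
  fix w
  show "rat_map (smult k P) (smult k Q) w = rat_map P Q w"
    using assms by (cases w) (simp_all add: rat_map_def Let_def)
qed

section \<open>Choosing a fixed point\<close>

lemma pderiv_at_root:
  assumes "G = [:-a, 1:] * K"
  shows "poly (pderiv G) a = poly K (a::complex)"
proof -
  have "pderiv G = [:-a, 1:] * pderiv K + K * pderiv [:-a, 1:]"
    unfolding assms by (rule pderiv_mult)
  then show ?thesis by (simp add: pderiv_pCons)
qed

text \<open>
  The sum of the residues of \<open>Q/G\<close> at its simple poles. It is the comparison of the coefficients of
  degree \<open>n\<close> in the Lagrange interpolation formula for \<open>Q\<close> at the \<open>n + 1\<close> roots of \<open>G\<close>.
\<close>

lemma sum_residues:
  fixes G Q :: "complex poly"
  assumes sf: "rsquarefree G" and G: "degree G = Suc n" and Q: "degree Q \<le> n"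
  shows "(\<Sum>a | poly G a = 0. poly Q a / poly (pderiv G) a) = coeff Q n / lead_coeff G"
proof -
  define A where "A = {a. poly G a = 0}"
  have "G \<noteq> 0" using G by auto
  have fin: "finite A" unfolding A_def by (rule poly_roots_finite[OF \<open>G \<noteq> 0\<close>])
  have "G = smult (lead_coeff G) (\<Prod>a\<in>A. [:-a, 1:])"
    using complex_poly_decompose_rsquarefree[OF sf] by (simp add: A_def)
  then have "degree G = degree (\<Prod>a\<in>A. [:-a, 1:])"
    using \<open>G \<noteq> 0\<close> by (metis degree_smult_eq leading_coeff_0_iff)
  also have "\<dots> = card A"
    by (subst degree_prod_eq_sum_degree) auto
  finally have card: "card A = Suc n" using G by simp
  have simple: "poly (pderiv G) a \<noteq> 0" if "a \<in> A" for a
    using sf that by (auto simp: rsquarefree_roots A_def)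
  define K where "K a = G div [:-a, 1:]" for a
  have K: "G = [:-a, 1:] * K a" if "a \<in> A" for a
    using that unfolding K_def A_def
    by (metis dvd_mult_div_cancel mem_Collect_eq poly_eq_0_iff_dvd)
  have degK: "degree (K a) = n" and lcK: "coeff (K a) n = lead_coeff G" if "a \<in> A" for a
  proof -
    have "K a \<noteq> 0" using K[OF that] \<open>G \<noteq> 0\<close> by auto
    then show "degree (K a) = n"
      using K[OF that] G degree_mult_eq[of "[:-a, 1:]" "K a"] by simp
    then show "coeff (K a) n = lead_coeff G"
      using K[OF that] lead_coeff_mult[of "[:-a, 1:]" "K a"] by simp
  qed
  define S where "S = (\<Sum>a\<in>A. smult (poly Q a / poly (pderiv G) a) (K a))"
  have "poly S b = poly Q b" if b: "b \<in> A" for b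
  proof -
    have "poly (K a) b = (if a = b then poly (pderiv G) b else 0)" if "a \<in> A" for a
    proof (cases "a = b")
      case True
      then show ?thesis using pderiv_at_root[OF K[OF b]] by simp
    next
      case False
      have "poly ([:-a, 1:] * K a) b = 0" using K[OF that] b by (simp add: A_def)
      then show ?thesis using False by simp
    qed
    then have "poly S b = (\<Sum>a\<in>A. if a = b then poly Q b else 0)"
      unfolding S_def poly_sum using simple by (intro sum.cong) auto
    then show ?thesis using fin b by simp
  qed
  moreover have "degree S \<le> n"
    unfolding S_def by (rule degree_sum_le[OF fin]) (use degK in \<open>auto intro: order_trans[OF degree_smult_le]\<close>)
  ultimately have "S = Q"
    using card Q by (intro poly_eqI_degree[of A]) auto
  moreover have "coeff S n = (\<Sum>a\<in>A. poly Q a / poly (pderiv G) a) * lead_coeff G"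
    unfolding S_def coeff_sum sum_distrib_right by (intro sum.cong) (simp_all add: lcK)
  ultimately show ?thesis
    using \<open>G \<noteq> 0\<close> by (simp add: A_def)
qed

lemma Re_pos_if_Re_inverse_pos:
  assumes "0 < Re (inverse z)"
  shows "0 < Re z"
proof -
  have "0 \<le> (Re z)\<^sup>2 + (Im z)\<^sup>2" by simp
  then show ?thesis using assms by (simp add: zero_less_divide_iff not_sum_power2_lt_zero)
qed

text \<open>
  The roots of \<open>G = z Q - P\<close> are the fixed points of \<open>P/Q\<close>, and at a root
  \<open>G'/Q = 1 - \<mu>\<close> for the multiplier \<open>\<mu>\<close>. As \<open>Q\<close> and \<open>G\<close> have the same leading coefficient, the sum of
  the residues of \<open>Q/G\<close> is \<open>1\<close>: this is the holomorphic fixed point formula, and one of its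
  terms \<open>1 / (1 - \<mu>)\<close> must have positive real part.
\<close>

lemma fixed_point_Re_multiplier_le_1:
  fixes P Q :: "complex poly"
  assumes Q: "degree Q = d" and P: "degree P \<le> d"
  defines "G \<equiv> pCons 0 Q - P"
  assumes d: "d \<ge> 1"
  obtains \<zeta> where "poly G \<zeta> = 0" "0 \<le> Re (poly (pderiv G) \<zeta> / poly Q \<zeta>)"
    "poly (pderiv G) \<zeta> = 0 \<or> rsquarefree G"
proof (cases "rsquarefree G")
  case False
  then show ?thesis using that by (auto simp: rsquarefree_roots)
next
  case True
  have cG: "coeff G (Suc d) = lead_coeff Q"
    unfolding G_def using Q P by (simp add: coeff_eq_0)
  have "Q \<noteq> 0" using Q d by auto
  have "degree G \<le> Suc d"
    unfolding G_def using P Q by (intro degree_diff_le) (auto simp: degree_pCons_le[THEN order_trans])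
  then have dG: "degree G = Suc d"
    using cG \<open>Q \<noteq> 0\<close> le_degree[of G "Suc d"] by auto
  have "(\<Sum>a | poly G a = 0. poly Q a / poly (pderiv G) a) = 1"
    using sum_residues[OF True dG, of Q] Q cG dG \<open>Q \<noteq> 0\<close> by auto
  then have "(\<Sum>a | poly G a = 0. Re (poly Q a / poly (pderiv G) a)) = 1"
    by (metis Re_sum one_complex.simps(1))
  then obtain a where "poly G a = 0" "0 < Re (poly Q a / poly (pderiv G) a)"
    using sum_nonpos[of "{a. poly G a = 0}" "\<lambda>a. Re (poly Q a / poly (pderiv G) a)"]
    by (auto simp: not_less[symmetric] intro: ccontr)
  moreover from this(2) have "0 < Re (poly (pderiv G) a / poly Q a)"
    using Re_pos_if_Re_inverse_pos[of "poly (pderiv G) a / poly Q a"] by simp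
  ultimately show ?thesis by (intro that[of a] less_imp_le disjI2 True)
qed

section \<open>Solving for the pole\<close>

text \<open>
  Here \<open>u\<close> stands for \<open>1 - \<mu>\<close>, so that the right-hand side is the norm of \<open>(\<mu> - d)\<^sup>d\<close>. Shifting a
  point of the right half plane by \<open>d - 1 \<ge> 1\<close> to the right increases its norm and makes it at
  least \<open>1\<close>, after which taking powers does no harm.
\<close>

lemma norm_shift_power_gt:
  fixes u :: complex
  assumes "d \<ge> 2" "0 \<le> Re u"
  shows "norm u < norm (1 - of_nat d - u) ^ d"
proof -
  define m where "m = real d - 1"
  have m: "m \<ge> 1" using assms by (simp add: m_def)
  define x where "x = norm (1 - of_nat d - u)"
  have "x\<^sup>2 = (norm u)\<^sup>2 + 2 * m * Re u + m\<^sup>2"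
    unfolding x_def cmod_power2 m_def by (simp add: power2_eq_square algebra_simps)
  moreover have "1 \<le> m\<^sup>2" "0 \<le> 2 * m * Re u" using m assms by simp_all
  ultimately have sq: "(norm u)\<^sup>2 + 1 \<le> x\<^sup>2" by linarith
  have "0 \<le> x" by (simp add: x_def)
  have "(norm u)\<^sup>2 < x\<^sup>2" using sq by linarith
  then have "norm u < x" using \<open>0 \<le> x\<close> by (rule power2_less_imp_less)
  moreover have "1\<^sup>2 \<le> x\<^sup>2" unfolding power_one using sq zero_le_power2[of "norm u"] by linarith
  then have "1 \<le> x" using \<open>0 \<le> x\<close> by (rule power2_le_imp_le)
  ultimately have "norm u < x" "x \<le> x ^ d"
    using self_le_power[of x d] assms by auto
  then show ?thesis unfolding x_def by linarith
qed

lemma single_root_poly: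
  fixes F :: "complex poly"
  assumes F: "degree F \<noteq> 0" and roots: "\<And>z. poly F z = 0 \<Longrightarrow> z = c"
  shows "F = smult (lead_coeff F) ([:-c, 1:] ^ degree F)"
proof -
  obtain z where "poly F z = 0"
    using fundamental_theorem_of_algebra[of F] F by (auto simp: constant_degree)
  then have "{z. poly F z = 0} = {c}" using roots by auto
  then have *: "smult (lead_coeff F) ([:-c, 1:] ^ Polynomial.order c F) = F"
    using complex_poly_decompose[of F] by simp
  have "F \<noteq> 0" using F by auto
  then have "degree F = Polynomial.order c F"
    by (subst *[symmetric]) (simp add: degree_power_eq)
  then show ?thesis using * by simp
qed

text \<open>
  The polynomial \<open>F = L - (m c - q)\<^sup>d\<close> has degree \<open>d\<close>. If its only root were that of \<open>m c - q\<close>, it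
  would be a multiple of \<open>(m c - q)\<^sup>d\<close>, and so would \<open>L\<close>.
\<close>

lemma exists_root_off_linear:
  fixes L :: "complex poly" and m q :: complex
  assumes d: "d \<ge> 1" and L: "degree L \<le> d" and ne: "coeff L d \<noteq> m ^ d" and m: "m \<noteq> 0"
    and not_power: "\<And>c. L \<noteq> smult (coeff L d) ([:-c, 1:] ^ d)"
  obtains c where "poly L c = (m * c - q) ^ d" "m * c - q \<noteq> 0"
proof -
  define M where "M = [:-q, m:]"
  have M: "M = smult m [:-(q / m), 1:]" using m by (simp add: M_def)
  define F where "F = L - M ^ d"
  have cF: "coeff F d = coeff L d - m ^ d"
    by (simp add: F_def M_def coeff_linear_power_top)
  have dF: "degree F = d"
  proof (rule antisym)
    show "degree F \<le> d"
      unfolding F_def M_def by (rule degree_diff_le[OF L degree_linear_power_le])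
    show "d \<le> degree F" using cF ne by (simp add: le_degree)
  qed
  have "\<exists>c. poly F c = 0 \<and> c \<noteq> q / m"
  proof (rule ccontr)
    assume "\<not> ?thesis"
    then have "F = smult (lead_coeff F) ([:-(q / m), 1:] ^ degree F)"
      using d dF by (intro single_root_poly) auto
    then have "F = smult (coeff L d - m ^ d) ([:-(q / m), 1:] ^ d)"
      by (simp only: dF cF)
    moreover have "M ^ d = smult (m ^ d) ([:-(q / m), 1:] ^ d)"
      unfolding M by (rule smult_power)
    ultimately have "L = smult (coeff L d) ([:-(q / m), 1:] ^ d)"
      unfolding F_def by (metis (no_types) diff_add_cancel smult_add_left)
    then show False using not_power by blast
  qed
  then obtain c where "poly F c = 0" "c \<noteq> q / m" by blast
  then show ?thesis
    using that[of c] m by (simp add: F_def M_def field_simps)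
qed

text \<open>
  Here \<open>1/c\<close> is the point that the conjugation moves to infinity, and \<open>coeff P 1\<close> is the multiplier of
  the fixed point \<open>0\<close>. Dividing \<open>z Q - P\<close> by \<open>z\<close> leaves a polynomial of degree \<open>d\<close> whose roots are the
  remaining fixed points; its reversal, evaluated at \<open>c\<close>, is the left-hand side of the last equation.
\<close>

lemma exists_normalizing_pole:
  fixes P Q :: "complex poly"
  assumes d: "d \<ge> 2" and Q: "degree Q = d" and P: "degree P \<le> d"
    and P0: "coeff P 0 = 0" and Q0: "coeff Q 0 = 1"
    and Re: "0 \<le> Re (1 - coeff P 1)"
    and simple: "coeff P 1 = 1 \<or> rsquarefree (pCons 0 Q - P)"
  obtains c \<kappa> where "\<kappa> \<noteq> 0" "\<kappa> = (coeff P 1 - of_nat d) * c - coeff Q 1"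
    "hom_eval d Q 1 c - c * hom_eval d P 1 c = \<kappa> ^ d"
proof -
  define P1 where "P1 = poly_shift 1 P"
  have P1: "P = pCons 0 P1"
    by (rule poly_eqI) (auto simp: P1_def coeff_poly_shift coeff_pCons P0 split: nat.split)
  define G1 where "G1 = Q - P1"
  have G: "pCons 0 Q - P = pCons 0 G1" by (simp add: G1_def P1)
  have cG1: "coeff G1 i = coeff Q i - coeff P (Suc i)" for i by (simp add: G1_def P1)
  have "Q \<noteq> 0" using Q0 by auto
  have dG1: "degree G1 = d"
  proof (rule antisym)
    show "degree G1 \<le> d"
      by (rule degree_le) (use P Q in \<open>simp add: cG1 coeff_eq_0\<close>)
    show "d \<le> degree G1"
      by (rule le_degree) (use P Q \<open>Q \<noteq> 0\<close> in \<open>auto simp: cG1 coeff_eq_0\<close>)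
  qed
  define L where "L = reflect_poly G1"
  have L_top: "coeff L d = 1 - coeff P 1"
    by (simp add: L_def coeff_reflect_poly dG1 cG1 Q0)
  have L_nz: "L \<noteq> 0" unfolding L_def using dG1 d by auto
  have L_eval: "hom_eval d Q 1 c - c * hom_eval d P 1 c = poly L c" for c
  proof (cases "c = 0")
    case True
    then show ?thesis
      using P by (simp add: hom_eval_infinity L_def dG1 cG1 coeff_eq_0)
  next
    case False
    have "poly (pCons 0 Q - P) (1 / c) = poly (pCons 0 G1) (1 / c)" by (simp only: G)
    then have "poly Q (1 / c) - c * poly P (1 / c) = poly G1 (1 / c)"
      using False by (simp add: field_simps)
    then show ?thesis
      using False P Q
      by (simp add: hom_eval_affine L_def poly_reflect_poly_nz dG1 inverse_eq_divide algebra_simps flip: right_diff_distrib)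
  qed
  have norm_lt: "norm (coeff L d) < norm (coeff P 1 - of_nat d) ^ d"
    using norm_shift_power_gt[OF d Re] by (simp add: L_top)
  \<comment> \<open>If \<open>L\<close> were such a power, all remaining fixed points would coincide, and there are \<open>d \<ge> 2\<close> of them.\<close>
  have not_power: "L \<noteq> smult (coeff L d) ([:-c, 1:] ^ d)" for c
  proof
    assume L: "L = smult (coeff L d) ([:-c, 1:] ^ d)"
    then have "coeff L d \<noteq> 0" using L_nz by auto
    then have "coeff P 1 \<noteq> 1" using L_top by simp
    then have sf: "rsquarefree (pCons 0 Q - P)" using simple by simp
    have "G1 = reflect_poly L"
      unfolding L_def using \<open>coeff P 1 \<noteq> 1\<close> by (simp add: cG1 Q0)
    also have "\<dots> = smult (coeff L d) (reflect_poly [:-c, 1:] ^ d)"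
      by (subst L) (simp only: reflect_poly_smult reflect_poly_power)
    also have "reflect_poly [:-c, 1:] = [:1, -c:]"
      by (rule poly_eqI) (auto simp: coeff_reflect_poly coeff_pCons le_Suc_eq not_less split: nat.split)
    finally have G1: "G1 = smult (coeff L d) ([:1, -c:] ^ d)" .
    have "c \<noteq> 0"
      using dG1 d unfolding G1 by (cases "c = 0") (auto simp flip: one_pCons)
    have "[:1, -c:] ^ 2 dvd G1"
      unfolding G1 using d by (intro dvd_smult le_imp_power_dvd)
    then have "[:1, -c:] ^ 2 dvd pCons 0 Q - P"
      unfolding G using dvd_mult[of _ G1 "[:0, 1:]"] by simp
    then obtain K where K: "pCons 0 Q - P = [:1, -c:] ^ 2 * K" by (rule dvdE)
    have "poly (pCons 0 Q - P) (1 / c) = 0" "poly (pderiv (pCons 0 Q - P)) (1 / c) = 0"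
      unfolding K power2_eq_square pderiv_mult poly_add poly_mult using \<open>c \<noteq> 0\<close> by simp_all
    then show False using sf unfolding rsquarefree_roots by blast
  qed
  obtain c where "poly L c = ((coeff P 1 - of_nat d) * c - coeff Q 1) ^ d"
    "(coeff P 1 - of_nat d) * c - coeff Q 1 \<noteq> 0"
  proof (rule exists_root_off_linear[of d L "coeff P 1 - of_nat d" "coeff Q 1"])
    show "degree L \<le> d" unfolding L_def using degree_reflect_poly_le[of G1] dG1 by simp
    show "coeff L d \<noteq> (coeff P 1 - of_nat d) ^ d" using norm_lt by (auto simp: norm_power)
    show "coeff P 1 - of_nat d \<noteq> 0" using norm_lt d by (auto simp: power_0_left)
  qed (use d not_power in auto)
  then show ?thesis using that L_eval by simp
qed

section \<open>Normalization\<close>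

lemma conj_infinity_not_fixed:
  assumes d: "d \<ge> 2" and R: "R \<in> Rat_d d"
  obtains P Q where "coprime P Q" "degree P \<le> d" "degree Q = d"
    "(R, rat_map P Q) \<in> moebius_conj"
proof -
  obtain P Q where R: "R = rat_map P Q" and cop: "coprime P Q"
    and deg: "max (degree P) (degree Q) = d"
    using R by (auto simp: Rat_d_def)
  have "pCons 0 Q - P \<noteq> 0"
  proof
    assume "pCons 0 Q - P = 0"
    then have P: "P = [:0, 1:] * Q" by simp
    then have "is_unit Q" using cop by (metis coprime_def dvd_refl dvd_triv_right)
    then have "degree Q = 0" "Q \<noteq> 0" by (auto simp: is_unit_iff_degree)
    then have "degree P \<le> 1" unfolding P by (simp add: degree_mult_eq)
    with \<open>degree Q = 0\<close> deg d show False by simp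
  qed
  then obtain p where p: "poly (pCons 0 Q - P) p \<noteq> 0"
    using poly_all_0_iff_0 by blast
  \<comment> \<open>\<open>T(z) = p + 1/z\<close> moves the point \<open>p\<close>, which is not fixed, to infinity.\<close>
  let ?P = "hom_subst d P [:1, p:] [:0, 1:]"
  let ?Q = "hom_subst d Q [:1, p:] [:0, 1:]"
  have le: "degree P \<le> d" "degree Q \<le> d" using deg by auto
  have nz: "coeff (smult p ?Q - smult 1 ?P) d \<noteq> 0"
    using p le unfolding coeff_diff coeff_smult coeff_hom_subst_top by (simp add: hom_eval_affine)
  have D: "p * 0 - 1 * 1 \<noteq> (0::complex)" by simp
  from moebius_conj_rat_map[OF cop deg D refl refl nz] show ?thesis
    using that R by blast
qed

text \<open>
  The equation for \<open>z Q' - P'\<close> transports the multiplicities of the fixed points and, through its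
  linear coefficient, the multiplier of \<open>\<zeta>\<close>.
\<close>

lemma translate_fixed_point:
  fixes P Q :: "complex poly"
  assumes cop: "coprime P Q" and P: "degree P \<le> d" and Q: "degree Q = d"
    and fixed: "poly (pCons 0 Q - P) \<zeta> = 0"
  obtains P' Q' where "coprime P' Q'" "degree P' \<le> d" "degree Q' = d"
    "coeff P' 0 = 0" "coeff Q' 0 = 1"
    "pCons 0 Q' - P' = smult (1 / poly Q \<zeta>) ((pCons 0 Q - P) \<circ>\<^sub>p [:\<zeta>, 1:])"
    "(rat_map P Q, rat_map P' Q') \<in> moebius_conj"
proof -
  define q where "q = poly Q \<zeta>"
  have q: "q \<noteq> 0"
    using fixed coprime_poly_no_common_root[OF cop, of \<zeta>] by (auto simp: q_def)
  have max: "max (degree P) (degree Q) = d" using P Q by simp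
  let ?P = "hom_subst d P [:\<zeta>, 1:] [:1, 0:]"
  let ?Q = "hom_subst d Q [:\<zeta>, 1:] [:1, 0:]"
  have subst: "hom_subst d S [:\<zeta>, 1:] [:1, 0:] = S \<circ>\<^sub>p [:\<zeta>, 1:]" if "degree S \<le> d" for S
    unfolding poly_eq_poly_eq_iff[symmetric]
    by (rule ext) (use that in \<open>simp add: poly_hom_subst hom_eval_affine poly_pcompose del: poly_eq_poly_eq_iff\<close>)
  define P1 where "P1 = smult 1 ?P - smult \<zeta> ?Q"
  define Q1 where "Q1 = smult 1 ?Q - smult 0 ?P"
  have eqs: "P1 = (P - smult \<zeta> Q) \<circ>\<^sub>p [:\<zeta>, 1:]" "Q1 = Q \<circ>\<^sub>p [:\<zeta>, 1:]"
    unfolding P1_def Q1_def subst[OF P] subst[OF eq_refl[OF Q]]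
    by (simp_all add: pcompose_diff pcompose_smult)
  have "Q1 \<noteq> 0" using q by (auto simp: eqs q_def pcompose_eq_0_iff)
  have "degree Q1 = d" using Q by (simp add: eqs)
  then have nz: "coeff Q1 d \<noteq> 0" using \<open>Q1 \<noteq> 0\<close> by auto
  have D: "1 * 1 - \<zeta> * 0 \<noteq> (0::complex)" by simp
  note conj = moebius_conj_rat_map[OF cop max D P1_def Q1_def nz]
  show ?thesis
  proof (rule that)
    show "coprime (smult (1 / q) P1) (smult (1 / q) Q1)"
      using q conj(1) by (intro coprime_smult_both) simp_all
    show "degree (smult (1 / q) P1) \<le> d" "degree (smult (1 / q) Q1) = d"
      using conj(2,3) q by simp_all
    show "coeff (smult (1 / q) P1) 0 = 0" "coeff (smult (1 / q) Q1) 0 = 1"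
      using fixed q by (simp_all add: eqs q_def flip: poly_0_coeff_0) (simp_all add: poly_pcompose)
    have "pCons 0 Q1 - P1 = (pCons 0 Q - P) \<circ>\<^sub>p [:\<zeta>, 1:]"
      unfolding poly_eq_poly_eq_iff[symmetric]
      by (rule ext) (simp add: eqs poly_pcompose algebra_simps)
    then show "pCons 0 (smult (1 / q) Q1) - smult (1 / q) P1
        = smult (1 / poly Q \<zeta>) ((pCons 0 Q - P) \<circ>\<^sub>p [:\<zeta>, 1:])"
      using smult_diff_right[of "1 / q" "pCons 0 Q1" P1] by (simp add: q_def)
    show "(rat_map P Q, rat_map (smult (1 / q) P1) (smult (1 / q) Q1)) \<in> moebius_conj"
      using conj(4) q by (simp add: rat_map_smult)
  qed
qed

lemma low_coeffs_hom_subst: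
  assumes "d \<ge> 1"
  shows "coeff (hom_subst d P [:0, 1:] [:\<kappa>, c:]) 0 = coeff P 0 * \<kappa> ^ d"
    and "coeff (hom_subst d P [:0, 1:] [:\<kappa>, c:]) 1
      = (of_nat d * c * coeff P 0 + coeff P 1) * \<kappa> ^ (d - 1)"
proof -
  have X: "[:0, 1:] ^ i = monom 1 i" for i :: nat
    by (simp add: monom_altdef)
  have lin: "coeff ([:\<kappa>, c:] ^ n) 0 = \<kappa> ^ n" for n
    by (simp add: coeff_0_power)
  have lin': "coeff ([:\<kappa>, c:] ^ n) (Suc 0) = of_nat n * c * \<kappa> ^ (n - 1)" for n
  proof (induction n)
    case (Suc n)
    then show ?case
      by (cases n) (simp_all add: algebra_simps coeff_0_power)
  qed simp
  have c: "coeff (hom_subst d P [:0, 1:] [:\<kappa>, c:]) k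
      = (\<Sum>i\<le>d. coeff P i * (if k < i then 0 else coeff ([:\<kappa>, c:] ^ (d - i)) (k - i)))" for k
    unfolding hom_subst_def X by (auto simp: coeff_sum coeff_monom_mult intro!: sum.cong)
  have "coeff (hom_subst d P [:0, 1:] [:\<kappa>, c:]) 0
      = (\<Sum>i\<in>{0}. coeff P i * (if 0 < i then 0 else coeff ([:\<kappa>, c:] ^ (d - i)) (0 - i)))"
    unfolding c by (rule sum.mono_neutral_right) auto
  then show "coeff (hom_subst d P [:0, 1:] [:\<kappa>, c:]) 0 = coeff P 0 * \<kappa> ^ d"
    by (simp add: lin)
  have "coeff (hom_subst d P [:0, 1:] [:\<kappa>, c:]) 1
      = (\<Sum>i\<in>{0, 1}. coeff P i * (if 1 < i then 0 else coeff ([:\<kappa>, c:] ^ (d - i)) (1 - i)))"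
    unfolding c by (rule sum.mono_neutral_right) (use assms in auto)
  then show "coeff (hom_subst d P [:0, 1:] [:\<kappa>, c:]) 1
      = (of_nat d * c * coeff P 0 + coeff P 1) * \<kappa> ^ (d - 1)"
    using lin[of "d - 1"] lin'[of d] by (simp add: algebra_simps)
qed

text \<open>
  Conjugation by \<open>T(z) = z / (c z + \<kappa>)\<close>. In the new denominator the coefficients of \<open>z\<^sup>d\<close> and \<open>1\<close> are
  both \<open>\<kappa>\<^sup>d\<close>, and the formula for \<open>\<kappa>\<close> makes that of \<open>z\<close> equal to \<open>- \<kappa>\<^sup>d\<close>; division by \<open>\<kappa>\<^sup>d\<close> normalizes
  all three at once.
\<close>

lemma conj_in_N_d:
  fixes P Q :: "complex poly"
  assumes d: "d \<ge> 2" and cop: "coprime P Q" and P: "degree P \<le> d" and Q: "degree Q = d"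
    and P0: "coeff P 0 = 0" and Q0: "coeff Q 0 = 1"
    and \<kappa>: "\<kappa> \<noteq> 0" "\<kappa> = (coeff P 1 - of_nat d) * c - coeff Q 1"
    and L: "hom_eval d Q 1 c - c * hom_eval d P 1 c = \<kappa> ^ d"
  shows "\<exists>S\<in>N_d d. (rat_map P Q, S) \<in> moebius_conj"
proof -
  let ?P = "hom_subst d P [:0, 1:] [:\<kappa>, c:]"
  let ?Q = "hom_subst d Q [:0, 1:] [:\<kappa>, c:]"
  define P1 where "P1 = smult \<kappa> ?P - smult 0 ?Q"
  define Q1 where "Q1 = smult 1 ?Q - smult c ?P"
  define k where "k = 1 / \<kappa> ^ d"
  have max: "max (degree P) (degree Q) = d" using P Q by simp
  have top: "coeff Q1 d = \<kappa> ^ d"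
    using L unfolding Q1_def coeff_diff coeff_smult coeff_hom_subst_top by simp
  then have nz: "coeff Q1 d \<noteq> 0" using \<kappa> by simp
  have D: "1 * \<kappa> - 0 * c \<noteq> 0" using \<kappa> by simp
  note conj = moebius_conj_rat_map[OF cop max D P1_def Q1_def nz]
  have k: "k \<noteq> 0" using \<kappa> by (simp add: k_def)
  have cop': "coprime (smult k P1) (smult k Q1)" using k conj(1) by (rule coprime_smult_both)
  have "coeff P1 0 = 0" "coeff Q1 0 = \<kappa> ^ d"
    using low_coeffs_hom_subst(1)[of d _ \<kappa> c] d P0 Q0 by (simp_all add: P1_def Q1_def)
  moreover have "coeff Q1 1 = - (\<kappa> ^ d)"
  proof -
    have "coeff Q1 1 = (of_nat d * c + coeff Q 1 - c * coeff P 1) * \<kappa> ^ (d - 1)"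
      using low_coeffs_hom_subst(2)[of d _ \<kappa> c] d P0 Q0 by (simp add: Q1_def algebra_simps)
    also have "of_nat d * c + coeff Q 1 - c * coeff P 1 = - \<kappa>"
      unfolding \<kappa>(2) by (simp add: algebra_simps)
    also have "- \<kappa> * \<kappa> ^ (d - 1) = - (\<kappa> ^ d)"
      using d by (cases d) simp_all
    finally show ?thesis .
  qed
  moreover have "canonical_form d (smult k P1) (smult k Q1)"
  proof -
    have "resultant (smult k P1) (smult k Q1) \<noteq> 0"
      using cop' by (simp add: resultant_0_gcd)
    then show ?thesis
      using conj(2,3) k top \<kappa> by (simp add: canonical_form_def k_def)
  qed
  ultimately have "canonical_form d (smult k P1) (smult k Q1) \<and> coeff (smult k P1) 0 = 0
      \<and> coeff (smult k Q1) 1 = -1 \<and> coeff (smult k Q1) 0 = 1"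
    using \<kappa>(1) by (simp add: k_def)
  then have "rat_map (smult k P1) (smult k Q1) \<in> N_d d"
    unfolding N_d_def by blast
  then show ?thesis using conj(4) rat_map_smult[OF k] by auto
qed

lemma conj_to_N_d:
  assumes d: "d \<ge> 2" and R: "R \<in> Rat_d d"
  shows "\<exists>S\<in>N_d d. (R, S) \<in> moebius_conj"
proof -
  obtain P Q where cop: "coprime P Q" and P: "degree P \<le> d" and Q: "degree Q = d"
    and R: "(R, rat_map P Q) \<in> moebius_conj"
    using conj_infinity_not_fixed[OF d R] .
  define G where "G = pCons 0 Q - P"
  obtain \<zeta> where \<zeta>: "poly G \<zeta> = 0" "0 \<le> Re (poly (pderiv G) \<zeta> / poly Q \<zeta>)"
    "poly (pderiv G) \<zeta> = 0 \<or> rsquarefree G"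
    using fixed_point_Re_multiplier_le_1[OF Q P] d unfolding G_def by auto
  obtain P' Q' where cop': "coprime P' Q'" and P': "degree P' \<le> d" and Q': "degree Q' = d"
    and P0: "coeff P' 0 = 0" and Q0: "coeff Q' 0 = 1"
    and G': "pCons 0 Q' - P' = smult (1 / poly Q \<zeta>) (G \<circ>\<^sub>p [:\<zeta>, 1:])"
    and R': "(rat_map P Q, rat_map P' Q') \<in> moebius_conj"
    using translate_fixed_point[OF cop P Q \<zeta>(1)[unfolded G_def]] unfolding G_def by metis
  have q: "poly Q \<zeta> \<noteq> 0"
    using \<zeta>(1) coprime_poly_no_common_root[OF cop, of \<zeta>] by (auto simp: G_def)
  have dG': "poly (pderiv (pCons 0 Q' - P')) z = poly (pderiv G) (\<zeta> + z) / poly Q \<zeta>" for z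
    unfolding G' by (simp add: pderiv_smult pderiv_pcompose poly_pcompose pderiv_pCons)
  have u: "1 - coeff P' 1 = poly (pderiv G) \<zeta> / poly Q \<zeta>"
    using dG'[of 0] Q0 by (simp add: pderiv_diff pderiv_pCons poly_0_coeff_0 coeff_pderiv)
  have "rsquarefree (pCons 0 Q' - P')" if "rsquarefree G"
    using that q dG' unfolding rsquarefree_roots
    by (simp add: G' poly_pcompose)
  then have simple: "coeff P' 1 = 1 \<or> rsquarefree (pCons 0 Q' - P')"
    using \<zeta>(3) u by auto
  obtain c \<kappa> where "\<kappa> \<noteq> 0" "\<kappa> = (coeff P' 1 - of_nat d) * c - coeff Q' 1"
    "hom_eval d Q' 1 c - c * hom_eval d P' 1 c = \<kappa> ^ d"
    using exists_normalizing_pole[OF d Q' P' P0 Q0 _ simple] \<zeta>(2) unfolding u[symmetric] by metis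
  then obtain S where "S \<in> N_d d" "(rat_map P' Q', S) \<in> moebius_conj"
    using conj_in_N_d[OF d cop' P' Q' P0 Q0] by blast
  then show ?thesis
    using R R' equiv_moebius_conj by (meson equivE transE)
qed

theorem theorem1:
  fixes d :: nat
  assumes "d \<ge> 2"
  shows "moebius_class ` N_d d = M_d d
         \<and> (\<forall>R\<in>Rat_d d. \<exists>T\<in>Moebius. inv_into UNIV T \<circ> R \<circ> T \<in> N_d d)"
proof
  have "M_d d = moebius_class ` Rat_d d"
    by (auto simp: M_d_def moebius_class_def quotient_def)
  also have "\<dots> = moebius_class ` N_d d"
  proof (intro equalityI subsetI)
    fix X assume "X \<in> moebius_class ` Rat_d d"
    then obtain R where "R \<in> Rat_d d" "X = moebius_class R" by auto
    moreover obtain S where "S \<in> N_d d" "(R, S) \<in> moebius_conj"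
      using conj_to_N_d[OF assms \<open>R \<in> Rat_d d\<close>] by auto
    moreover from this(2) have "moebius_class R = moebius_class S"
      unfolding moebius_class_def by (rule equiv_class_eq[OF equiv_moebius_conj])
    ultimately show "X \<in> moebius_class ` N_d d" by simp
  qed (use N_d_subset_C_d[of d] C_d_subset_Rat_d[of d] in auto)
  finally show "moebius_class ` N_d d = M_d d" ..
  show "\<forall>R\<in>Rat_d d. \<exists>T\<in>Moebius. inv_into UNIV T \<circ> R \<circ> T \<in> N_d d"
  proof
    fix R assume "R \<in> Rat_d d"
    then obtain S where "S \<in> N_d d" "(R, S) \<in> moebius_conj"
      using conj_to_N_d[OF assms] by auto
    then show "\<exists>T\<in>Moebius. inv_into UNIV T \<circ> R \<circ> T \<in> N_d d"
      by (auto simp: moebius_conj_def)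
  qed
qed

end
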